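(* Let $\mathbb F$ be a field of characteristic zero, let $(A,\cdot)$ be an associative commutative algebra over $\mathbb F$, and let $D$ be a derivation of $A$. Define $[x,y]:=xD(y)-D(x)y$ for $x,y\in A$, so that $(A,\cdot,[\,,])$ is a transposed Poisson algebra. Fix $u\in A$ and let $\circ=\llbracket[\,,],\cdot\rrbracket$ and $\{\,,\}=\llbracket\cdot,[\,,]\rrbracket$ be the Kantor products with respect to $u$. Then $(A,\circ,\{\,,\})$ is a transposed Poisson algebra.
   Context: For bilinear multiplications $P,Q$ on a vector space $V$ and a fixed $u\in V$, the Kantor product $\llbracket P,Q\rrbracket$ (with respect to $u$) is the bilinear multiplication $\llbracket P,Q\rrbracket(x,y)=P(u,Q(x,y))-Q(P(u,x),y)-Q(x,P(u,y))$. A transposed Poisson algebra $(A,\cdot,[\,,])$ is a vector space with two bilinear operations such that $(A,\cdot)$ is an associative commutative algebra (not necessarily unital), $(A,[\,,])$ is a Lie algebra, and $2z\cdot[x,y]=[z\cdot x,y]+[x,z\cdot y]$ for all $x,y,z\in A$. *)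

theory Defs
  imports Complex_Main
begin

text \<open>
  The underlying vector space is a type of class \<open>ab_group_add\<close> together with a scalar
  multiplication that satisfies the locale \<open>vector_space\<close>; the operations are functions on
  that type.
\<close>

locale bilinear_multiplication = vector_space scale
  for scale :: "'f::field \<Rightarrow> 'a::ab_group_add \<Rightarrow> 'a" +
  fixes mult :: "'a \<Rightarrow> 'a \<Rightarrow> 'a"
  assumes linear_right: "Vector_Spaces.linear scale scale (\<lambda>y. mult x y)"
    and linear_left: "Vector_Spaces.linear scale scale (\<lambda>x. mult x y)"

locale assoc_comm_algebra = bilinear_multiplication scale mult
  for scale :: "'f::field \<Rightarrow> 'a::ab_group_add \<Rightarrow> 'a"
    and mult :: "'a \<Rightarrow> 'a \<Rightarrow> 'a" +
  assumes mult_assoc: "mult (mult x y) z = mult x (mult y z)"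
    and mult_commute: "mult x y = mult y x"

locale lie_algebra = bilinear_multiplication scale bracket
  for scale :: "'f::field \<Rightarrow> 'a::ab_group_add \<Rightarrow> 'a"
    and bracket :: "'a \<Rightarrow> 'a \<Rightarrow> 'a" +
  assumes bracket_self: "bracket x x = 0"
    and jacobi: "bracket x (bracket y z) + bracket y (bracket z x) + bracket z (bracket x y) = 0"

locale transposed_poisson_algebra =
  assoc_comm_algebra scale mult + lie_algebra scale bracket
  for scale :: "'f::field \<Rightarrow> 'a::ab_group_add \<Rightarrow> 'a"
    and mult :: "'a \<Rightarrow> 'a \<Rightarrow> 'a"
    and bracket :: "'a \<Rightarrow> 'a \<Rightarrow> 'a" +
  assumes transposed_leibniz:
    "scale 2 (mult z (bracket x y)) = bracket (mult z x) y + bracket x (mult z y)"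

definition derivation ::
  "('f::field \<Rightarrow> 'a::ab_group_add \<Rightarrow> 'a) \<Rightarrow> ('a \<Rightarrow> 'a \<Rightarrow> 'a) \<Rightarrow> ('a \<Rightarrow> 'a) \<Rightarrow> bool"
  where "derivation scale mult D \<longleftrightarrow>
    Vector_Spaces.linear scale scale D \<and>
    (\<forall>x y. D (mult x y) = mult (D x) y + mult x (D y))"

definition derivation_bracket ::
  "('a::ab_group_add \<Rightarrow> 'a \<Rightarrow> 'a) \<Rightarrow> ('a \<Rightarrow> 'a) \<Rightarrow> 'a \<Rightarrow> 'a \<Rightarrow> 'a"
  where "derivation_bracket mult D x y = mult x (D y) - mult (D x) y"

definition kantor_product ::
  "'a::ab_group_add \<Rightarrow> ('a \<Rightarrow> 'a \<Rightarrow> 'a) \<Rightarrow> ('a \<Rightarrow> 'a \<Rightarrow> 'a) \<Rightarrow> 'a \<Rightarrow> 'a \<Rightarrow> 'a"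
  where "kantor_product u P Q x y = P u (Q x y) - Q (P u x) y - Q x (P u y)"

end

theory Submission imports Defs
begin

text \<open>
  Both Kantor products collapse to simple closed forms. Expanding the first one, all terms that
  contain \<open>D x\<close> or \<open>D y\<close> cancel, so the product \<open>\<circ>\<close> of \<open>x\<close> and \<open>y\<close> is \<open>D u \<cdot> (x \<cdot> y)\<close>: the
  mutation of the multiplication by the fixed element \<open>D u\<close>. In the second one, the transposed
  Leibniz rule \<open>[u \<cdot> x, y] + [x, u \<cdot> y] = 2 u \<cdot> [x, y]\<close> leaves \<open>{x, y} = - u \<cdot> [x, y]\<close>, which is
  the bracket defined by the map \<open>- u \<cdot> D\<close>, again a derivation because the multiplication is
  associative and commutative.

  Hence the claim splits into two general facts: the bracket of any derivation makes an
  associative commutative algebra transposed Poisson (\<open>derivation_bracket_transposed_poisson\<close>),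
  and replacing the multiplication of a transposed Poisson algebra by a mutation keeps it
  transposed Poisson (\<open>mutation_transposed_poisson\<close>). The first is applied to \<open>D\<close> and to
  \<open>- u \<cdot> D\<close>, the second to the resulting bracket of \<open>- u \<cdot> D\<close> and the element \<open>D u\<close>.
\<close>

context bilinear_multiplication
begin

lemmas mult_linear =
  linear_left[THEN Vector_Spaces.linear.axioms(3)] linear_right[THEN Vector_Spaces.linear.axioms(3)]

lemma mult_add_left: "mult (x + y) z = mult x z + mult y z"
  using module_hom.add[OF mult_linear(1)] .

lemma mult_add_right: "mult z (x + y) = mult z x + mult z y"
  using module_hom.add[OF mult_linear(2)] .

lemma mult_diff_left: "mult (x - y) z = mult x z - mult y z"
  using module_hom.diff[OF mult_linear(1)] .

lemma mult_diff_right: "mult z (x - y) = mult z x - mult z y"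
  using module_hom.diff[OF mult_linear(2)] .

lemma mult_minus_left: "mult (- x) z = - mult x z"
  using module_hom.neg[OF mult_linear(1)] .

lemma mult_minus_right: "mult z (- x) = - mult z x"
  using module_hom.neg[OF mult_linear(2)] .

lemma mult_scale_left: "mult (scale c x) z = scale c (mult x z)"
  using module_hom.scale[OF mult_linear(1)] .

lemma mult_scale_right: "mult z (scale c x) = scale c (mult z x)"
  using module_hom.scale[OF mult_linear(2)] .

lemmas mult_bilinear = mult_add_left mult_add_right mult_diff_left mult_diff_right
  mult_minus_left mult_minus_right mult_scale_left mult_scale_right

lemma scale_two: "scale 2 x = x + x"
  using scale_left_distrib[of 1 1 x] by simp

end

lemma (in vector_space) linearI:
  assumes "\<And>x y. f (x + y) = f x + f y" and "\<And>c x. f (scale c x) = scale c (f x)"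
  shows "Vector_Spaces.linear scale scale f"
  using assms by (unfold_locales) auto

context assoc_comm_algebra
begin

lemma mutation_bilinear: "bilinear_multiplication scale (\<lambda>x y. mult w (mult x y))"
  by unfold_locales (simp_all add: mult_bilinear)

lemma mult_left_commute: "mult x (mult y z) = mult y (mult x z)"
  by (metis mult_assoc mult_commute)

lemmas mult_ac = mult_assoc mult_commute mult_left_commute

context
  fixes D
  assumes D: "derivation scale mult D"
begin

lemma derivation_linear: "module_hom scale scale D"
  using D by (simp add: derivation_def Vector_Spaces.linear_def)

lemmas derivation_rules =
  module_hom.add[OF derivation_linear] module_hom.diff[OF derivation_linear]
  module_hom.scale[OF derivation_linear]

lemma derivation_mult: "D (mult x y) = mult (D x) y + mult x (D y)"
  using D by (simp add: derivation_def)

text \<open>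
  For the Jacobi identity, the products \<open>D y \<cdot> D z\<close> cancel within \<open>D [y, z]\<close>, so \<open>[x, [y, z]]\<close>
  equals \<open>x \<cdot> y \<cdot> D (D z) - x \<cdot> z \<cdot> D (D y) - D x \<cdot> D z \<cdot> y + D x \<cdot> D y \<cdot> z\<close>. Its first two terms
  cancel in the cyclic sum, and so do its last two.
\<close>

lemma derivation_bracket_transposed_poisson:
  "transposed_poisson_algebra scale mult (derivation_bracket mult D)"
proof unfold_locales
  fix x y z
  show "derivation_bracket mult D x x = 0"
    by (simp add: derivation_bracket_def mult_commute)
  show "derivation_bracket mult D x (derivation_bracket mult D y z) +
      derivation_bracket mult D y (derivation_bracket mult D z x) +
      derivation_bracket mult D z (derivation_bracket mult D x y) = 0"
    by (simp add: derivation_bracket_def derivation_rules derivation_mult mult_bilinear mult_ac)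
  show "scale 2 (mult z (derivation_bracket mult D x y)) =
      derivation_bracket mult D (mult z x) y + derivation_bracket mult D x (mult z y)"
    by (simp add: scale_two derivation_bracket_def derivation_mult mult_bilinear mult_ac)
qed (simp_all add: derivation_bracket_def derivation_rules mult_bilinear algebra_simps
  scale_right_diff_distrib)

lemma derivation_neg_multiple: "derivation scale mult (\<lambda>x. - mult u (D x))"
  unfolding derivation_def
proof (intro conjI allI)
  show "Vector_Spaces.linear scale scale (\<lambda>x. - mult u (D x))"
    by (rule linearI) (simp_all add: derivation_rules mult_bilinear)
  show "- mult u (D (mult x y)) = mult (- mult u (D x)) y + mult x (- mult u (D y))" for x y
    by (simp add: derivation_mult mult_bilinear mult_ac)
qed

lemma kantor_product_bracket_mult:
  "kantor_product u (derivation_bracket mult D) mult = (\<lambda>x y. mult (D u) (mult x y))"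
  by (intro ext) (simp add: kantor_product_def derivation_bracket_def derivation_mult
    mult_bilinear mult_ac)

lemma kantor_product_mult_bracket:
  "kantor_product u mult (derivation_bracket mult D) =
    derivation_bracket mult (\<lambda>x. - mult u (D x))"
  by (intro ext) (simp add: kantor_product_def derivation_bracket_def derivation_mult
    mult_bilinear mult_ac)

end

end

text \<open>
  The compatibility law with \<open>w \<cdot> z\<close> in place of \<open>z\<close> is exactly the compatibility law of the
  mutation by \<open>w\<close>; the bracket is untouched.
\<close>

lemma (in transposed_poisson_algebra) mutation_transposed_poisson:
  "transposed_poisson_algebra scale (\<lambda>x y. mult w (mult x y)) bracket"
proof (intro transposed_poisson_algebra.intro assoc_comm_algebra.intro mutation_bilinear
    lie_algebra_axioms assoc_comm_algebra_axioms.intro transposed_poisson_algebra_axioms.intro)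
  fix x y z
  show "mult w (mult (mult w (mult x y)) z) = mult w (mult x (mult w (mult y z)))"
    by (simp add: mult_ac)
  show "mult w (mult x y) = mult w (mult y x)"
    by (simp add: mult_commute)
  show "scale 2 (mult w (mult z (bracket x y))) =
      bracket (mult w (mult z x)) y + bracket x (mult w (mult z y))"
    using transposed_leibniz[of "mult w z" x y] by (simp add: mult_assoc)
qed

theorem proposition28:
  fixes scale :: "'f::field_char_0 \<Rightarrow> 'a::ab_group_add \<Rightarrow> 'a"
    and mult :: "'a \<Rightarrow> 'a \<Rightarrow> 'a"
    and D :: "'a \<Rightarrow> 'a"
    and u :: 'a
  assumes "assoc_comm_algebra scale mult"
    and "derivation scale mult D"
  shows "transposed_poisson_algebra scale mult (derivation_bracket mult D) \<and>
    transposed_poisson_algebra scale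
      (kantor_product u (derivation_bracket mult D) mult)
      (kantor_product u mult (derivation_bracket mult D))"
proof -
  interpret assoc_comm_algebra scale mult by fact
  show ?thesis
    unfolding kantor_product_bracket_mult[OF assms(2)] kantor_product_mult_bracket[OF assms(2)]
    by (intro conjI transposed_poisson_algebra.mutation_transposed_poisson
      derivation_bracket_transposed_poisson derivation_neg_multiple assms(2))
qed

end
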